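(* Let $n\ge 1$ and let $v$ be a non-zero element of $\mathbb{C}^n$. Then the complex $n$-dimensional vector space $$\mathcal{E}_v=\{\phi_a:\mathrm{GL}_n(\mathbb{C})\to\mathbb{C}\mid \phi_a(z)=\operatorname{trace}(v^t a z^t),\ a\in\mathbb{C}^n\}$$ is an eigenfamily on the semi-Riemannian Lie group $\mathrm{GL}_n(\mathbb{C})$ such that for all $\phi,\psi\in\mathcal{E}_v$ we have $$\tau(\phi)=-2n\cdot\phi\quad\text{and}\quad\kappa(\phi,\psi)=-2\cdot\phi\cdot\psi.$$
   Context: Elements of $\mathbb{C}^n$ are row vectors, so $v^ta$ is the $n\times n$ matrix $(v_ja_\alpha)_{j\alpha}$. The real Lie group $\mathrm{GL}_n(\mathbb{C})$ carries the left-invariant semi-Riemannian metric $g$ determined by $g(Z,W)=-\operatorname{Re}\operatorname{trace}(ZW)$ on its Lie algebra $\mathfrak{gl}_n(\mathbb{C})=\mathbb{C}^{n\times n}$. For smooth complex-valued functions $\phi,\psi$, $\tau(\phi)=\operatorname{div}(\nabla\phi)$ is the Laplace-Beltrami operator (tension field) and $\kappa(\phi,\psi)=g(\nabla\phi,\nabla\psi)$ is the conformality operator, where $g$ is extended complex-bilinearly to the complexified tangent bundle. A set $\mathcal{E}$ of complex-valued functions is an eigenfamily if there exist $\lambda,\mu\in\mathbb{C}$ with $\tau(\phi)=\lambda\phi$ and $\kappa(\phi,\psi)=\mu\phi\psi$ for all $\phi,\psi\in\mathcal{E}$. *)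

theory Defs
  imports "HOL-Analysis.Analysis" "HOL-Library.Function_Algebras"
begin

section \<open>Semi-Riemannian geometry on an open subset of a Euclidean space\<close>

text \<open>
  The manifold is an open set \<open>U\<close> of a finite-dimensional real vector space \<open>'a\<close>, so every
  tangent space is \<open>'a\<close> and a metric is a family \<open>g z\<close> of symmetric, nondegenerate (possibly
  indefinite) bilinear forms on \<open>'a\<close>, for \<open>z \<in> U\<close>. Functions and vector fields on \<open>U\<close> are
  represented by functions on all of \<open>'a\<close>. As \<open>U\<close> is open, the operators below, evaluated at a
  point of \<open>U\<close>, depend on the values on \<open>U\<close> only. The auxiliary Euclidean inner product of \<open>'a\<close>
  occurs only in writing down the trace of an endomorphism.
\<close>

primrec Ck_on :: "nat \<Rightarrow> 'a::euclidean_space set \<Rightarrow> ('a \<Rightarrow> 'b::real_normed_vector) \<Rightarrow> bool" where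
  "Ck_on 0 U f \<longleftrightarrow> continuous_on U f"
| "Ck_on (Suc k) U f \<longleftrightarrow>
     (\<forall>z\<in>U. f differentiable (at z)) \<and> (\<forall>v. Ck_on k U (\<lambda>z. frechet_derivative f (at z) v))"

definition smooth_on :: "'a::euclidean_space set \<Rightarrow> ('a \<Rightarrow> 'b::real_normed_vector) \<Rightarrow> bool" where
  "smooth_on U f \<longleftrightarrow> (\<forall>k. Ck_on k U f)"

definition gradient ::
  "('a::euclidean_space \<Rightarrow> 'a \<Rightarrow> 'a \<Rightarrow> real) \<Rightarrow> ('a \<Rightarrow> real) \<Rightarrow> 'a \<Rightarrow> 'a" where
  "gradient g f z = (THE X. \<forall>Y. g z X Y = frechet_derivative f (at z) Y)"

text \<open>
  The Christoffel form is \<open>\<nabla>\<^sub>X Y\<close> at \<open>z\<close> for constant vector fields \<open>X\<close> and \<open>Y\<close>, where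
  \<open>\<nabla>\<close> is the Levi-Civita connection. It is given by the Koszul formula, whose bracket terms
  vanish for constant fields.
\<close>

definition christoffel ::
  "('a::euclidean_space \<Rightarrow> 'a \<Rightarrow> 'a \<Rightarrow> real) \<Rightarrow> 'a \<Rightarrow> 'a \<Rightarrow> 'a \<Rightarrow> 'a" where
  "christoffel g z X Y = (THE W. \<forall>Z.
     2 * g z W Z = frechet_derivative (\<lambda>w. g w Y Z) (at z) X
                 + frechet_derivative (\<lambda>w. g w X Z) (at z) Y
                 - frechet_derivative (\<lambda>w. g w X Y) (at z) Z)"

text \<open>The value at \<open>z\<close> of \<open>\<nabla>\<^sub>X Y\<close>, for a tangent vector \<open>X\<close> at \<open>z\<close> and a vector field \<open>Y\<close>.\<close>

definition covariant_derivative ::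
  "('a::euclidean_space \<Rightarrow> 'a \<Rightarrow> 'a \<Rightarrow> real) \<Rightarrow> ('a \<Rightarrow> 'a) \<Rightarrow> 'a \<Rightarrow> 'a \<Rightarrow> 'a" where
  "covariant_derivative g Y z X = frechet_derivative Y (at z) X + christoffel g z X (Y z)"

definition divergence ::
  "('a::euclidean_space \<Rightarrow> 'a \<Rightarrow> 'a \<Rightarrow> real) \<Rightarrow> ('a \<Rightarrow> 'a) \<Rightarrow> 'a \<Rightarrow> real" where
  "divergence g Y z = (\<Sum>b\<in>Basis. covariant_derivative g Y z b \<bullet> b)"

text \<open>
  A vector \<open>X + \<i>Y\<close> of the complexified tangent space is the pair \<open>(X, Y)\<close>. This \<open>\<i>\<close> is unrelated
  to any complex structure that \<open>'a\<close> may carry itself, for instance when \<open>'a\<close> consists of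
  complex matrices.
\<close>

definition complex_bilinear_extension ::
  "('a \<Rightarrow> 'a \<Rightarrow> real) \<Rightarrow> 'a \<times> 'a \<Rightarrow> 'a \<times> 'a \<Rightarrow> complex" where
  "complex_bilinear_extension h Z W =
     Complex (h (fst Z) (fst W) - h (snd Z) (snd W)) (h (fst Z) (snd W) + h (snd Z) (fst W))"

definition complex_gradient ::
  "('a::euclidean_space \<Rightarrow> 'a \<Rightarrow> 'a \<Rightarrow> real) \<Rightarrow> ('a \<Rightarrow> complex) \<Rightarrow> 'a \<Rightarrow> 'a \<times> 'a" where
  "complex_gradient g \<phi> z = (gradient g (\<lambda>w. Re (\<phi> w)) z, gradient g (\<lambda>w. Im (\<phi> w)) z)"

definition complex_divergence ::
  "('a::euclidean_space \<Rightarrow> 'a \<Rightarrow> 'a \<Rightarrow> real) \<Rightarrow> ('a \<Rightarrow> 'a \<times> 'a) \<Rightarrow> 'a \<Rightarrow> complex" where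
  "complex_divergence g Z z =
     Complex (divergence g (\<lambda>w. fst (Z w)) z) (divergence g (\<lambda>w. snd (Z w)) z)"

definition tension ::
  "('a::euclidean_space \<Rightarrow> 'a \<Rightarrow> 'a \<Rightarrow> real) \<Rightarrow> ('a \<Rightarrow> complex) \<Rightarrow> 'a \<Rightarrow> complex" where
  "tension g \<phi> = complex_divergence g (complex_gradient g \<phi>)"

definition conformality ::
  "('a::euclidean_space \<Rightarrow> 'a \<Rightarrow> 'a \<Rightarrow> real) \<Rightarrow> ('a \<Rightarrow> complex) \<Rightarrow> ('a \<Rightarrow> complex) \<Rightarrow> 'a \<Rightarrow> complex" where
  "conformality g \<phi> \<psi> z =
     complex_bilinear_extension (g z) (complex_gradient g \<phi> z) (complex_gradient g \<psi> z)"

definition eigenfamily ::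
  "'a::euclidean_space set \<Rightarrow> ('a \<Rightarrow> 'a \<Rightarrow> 'a \<Rightarrow> real) \<Rightarrow> ('a \<Rightarrow> complex) set \<Rightarrow> bool" where
  "eigenfamily U g \<E> \<longleftrightarrow>
     (\<forall>\<phi>\<in>\<E>. smooth_on U \<phi>) \<and>
     (\<exists>l m. \<forall>\<phi>\<in>\<E>. \<forall>\<psi>\<in>\<E>. \<forall>z\<in>U.
        tension g \<phi> z = l * \<phi> z \<and> conformality g \<phi> \<psi> z = m * \<phi> z * \<psi> z)"


section \<open>The semi-Riemannian Lie group of invertible complex matrices\<close>

definition GL :: "(complex^'n^'n) set" where
  "GL = {z. invertible z}"

definition gl_form :: "complex^'n^'n \<Rightarrow> complex^'n^'n \<Rightarrow> real" where
  "gl_form Z W = - Re (trace (Z ** W))"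

text \<open>The differential of left translation by \<open>z\<^sup>-\<^sup>1\<close> is \<open>X \<mapsto> z\<^sup>-\<^sup>1 X\<close>.\<close>

definition gl_metric :: "complex^'n^'n \<Rightarrow> complex^'n^'n \<Rightarrow> complex^'n^'n \<Rightarrow> real" where
  "gl_metric z X Y = gl_form (matrix_inv z ** X) (matrix_inv z ** Y)"

lemma matrix_inv_GL:
  assumes "z \<in> GL"
  shows "z ** matrix_inv z = mat 1" "matrix_inv z ** z = mat 1"
proof -
  have "\<exists>B. z ** B = mat 1 \<and> B ** z = mat 1"
    using assms by (simp add: GL_def invertible_def)
  then have "z ** matrix_inv z = mat 1 \<and> matrix_inv z ** z = mat 1"
    unfolding matrix_inv_def by (rule someI_ex)
  then show "z ** matrix_inv z = mat 1" "matrix_inv z ** z = mat 1" by auto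
qed

lemma open_GL: "open (GL :: (complex^'n^'n) set)"
proof -
  have "continuous_on UNIV (det :: complex^'n^'n \<Rightarrow> complex)"
    unfolding det_def by (intro continuous_intros)
  moreover have "(GL :: (complex^'n^'n) set) = det -` (- {0})"
    by (auto simp: GL_def invertible_det_nz)
  ultimately show ?thesis
    by (metis open_vimage open_Compl closed_singleton)
qed

lemma gl_metric_mat_1: "gl_metric (mat 1 :: complex^'n^'n) = gl_form"
proof -
  have "invertible (mat 1 :: complex^'n^'n)"
    unfolding invertible_def by (rule exI[of _ "mat 1"]) simp
  then have "(mat 1 :: complex^'n^'n) \<in> GL" by (simp add: GL_def)
  from matrix_inv_GL(1)[OF this] show ?thesis
    by (simp add: gl_metric_def fun_eq_iff)
qed

lemma gl_metric_left_invariant: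
  fixes w z X Y :: "complex^'n^'n"
  assumes "w \<in> GL" "z \<in> GL"
  shows "gl_metric (w ** z) (w ** X) (w ** Y) = gl_metric z X Y"
proof -
  have wz: "w ** z \<in> GL" using assms by (simp add: GL_def invertible_mult)
  have "matrix_inv (w ** z) ** (w ** V) = matrix_inv z ** V" for V :: "complex^'n^'n"
  proof -
    have "w ** V = (w ** z) ** (matrix_inv z ** V)"
      by (metis matrix_mul_assoc matrix_mul_rid matrix_inv_GL(1)[OF assms(2)])
    then show ?thesis
      by (metis matrix_mul_assoc matrix_mul_lid matrix_inv_GL(2)[OF wz])
  qed
  then show ?thesis by (simp add: gl_metric_def)
qed

lemma gl_metric_symmetric: "gl_metric z X Y = gl_metric z Y X"
  unfolding gl_metric_def gl_form_def by (subst trace_mul_sym) (rule refl)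

lemma gl_metric_bilinear: "bilinear (gl_metric z)"
proof -
  have add: "gl_metric z (X + Y) Z = gl_metric z X Z + gl_metric z Y Z" for X Y Z
    by (simp add: gl_metric_def gl_form_def matrix_matrix_mult_def trace_def
        algebra_simps sum.distrib)
  have cmult: "gl_metric z (c *\<^sub>R X) Z = c * gl_metric z X Z" for c X Z
    by (simp add: gl_metric_def gl_form_def matrix_scalar_ac trace_def
        flip: scalar_matrix_assoc sum_distrib_left)
  have "linear (\<lambda>X. gl_metric z X Y)" for Y
    by (rule linearI) (simp_all add: add cmult)
  moreover from this have "linear (\<lambda>Y. gl_metric z X Y)" for X
    by (simp add: gl_metric_symmetric[of z X])
  ultimately show ?thesis by (simp add: bilinear_def)
qed

lemma gl_metric_nondegenerate:
  fixes z X :: "complex^'n^'n"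
  assumes "z \<in> GL" and "\<And>Y. gl_metric z X Y = 0"
  shows "X = 0"
proof -
  define P where "P = matrix_inv z ** X"
  define Q :: "complex^'n^'n" where "Q = (\<chi> i j. cnj (P$j$i))"
  have "matrix_inv z ** (z ** Q) = Q"
    by (simp add: matrix_mul_assoc matrix_inv_GL assms(1))
  then have "Re (trace (P ** Q)) = 0"
    using assms(2)[of "z ** Q"] by (simp add: gl_metric_def gl_form_def P_def)
  moreover have "Re (trace (P ** Q)) = (\<Sum>i\<in>UNIV. \<Sum>j\<in>UNIV. (cmod (P$i$j))\<^sup>2)"
    by (simp add: trace_def matrix_matrix_mult_def Q_def complex_mult_cnj cmod_power2)
  ultimately have "P$i$j = 0" for i j
    by (simp add: sum_nonneg_eq_0_iff sum_nonneg)
  then have "P = 0" by (simp add: vec_eq_iff)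
  have "X = z ** P"
    by (simp add: P_def matrix_mul_assoc matrix_inv_GL assms(1))
  with \<open>P = 0\<close> show ?thesis by simp
qed


section \<open>The functions under consideration\<close>

text \<open>
  Functions \<open>GL \<Rightarrow> complex\<close> are modelled as functions on all matrices that are zero outside \<open>GL\<close>,
  so that two of them are equal iff they agree on \<open>GL\<close>, and the complex vector space structure
  on them is the pointwise one.
\<close>

interpretation cfun: vector_space "\<lambda>(c::complex) (f::'a \<Rightarrow> complex) x. c * f x"
  by unfold_locales (auto simp: fun_eq_iff algebra_simps)

definition phi :: "complex^'n \<Rightarrow> complex^'n \<Rightarrow> complex^'n^'n \<Rightarrow> complex" where
  "phi v a z =
     (if z \<in> GL
      then trace (transpose (rowvector v :: complex^'n^1) ** (rowvector a :: complex^'n^1) ** transpose z)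
      else 0)"

definition E_fam :: "complex^'n \<Rightarrow> (complex^'n^'n \<Rightarrow> complex) set" where
  "E_fam v = {phi v a | a. True}"

end

theory Submission
  imports Defs
begin

text \<open>
  On \<open>GL\<close> the function \<open>phi v a\<close> is the restriction of the linear form \<open>z \<mapsto> trace (A z)\<close> with
  \<open>A = a\<^sup>t v\<close> of rank one. For any \<open>A\<close>, the gradient of \<open>Re (trace (A z))\<close> is \<open>- z A z\<close>. The
  derivative of \<open>z \<mapsto> z\<^sup>-\<^sup>1\<close> and the Koszul formula show that the Christoffel form is
  \<open>- (X z\<^sup>-\<^sup>1 Y + Y z\<^sup>-\<^sup>1 X) / 2\<close>, so the covariant derivative of the gradient is the endomorphism
  \<open>X \<mapsto> - (z A X + X A z) / 2\<close>, whose real trace is \<open>- 2 n Re (trace (A z))\<close>. The eigenvalue of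
  the conformality operator comes from
  \<open>trace (A z B z) = trace (A z) trace (B z)\<close>, valid for \<open>A = a\<^sup>t v\<close> and \<open>B = b\<^sup>t v\<close>. Imaginary
  parts are covered because \<open>Im (phi v a) = Re (phi v (- \<i> a))\<close>.
\<close>

section \<open>Matrix calculus\<close>

lemma bounded_bilinear_matrix_mult:
  "bounded_bilinear ((**) :: complex^'n^'m \<Rightarrow> complex^'p^'n \<Rightarrow> complex^'p^'m)"
proof -
  have "linear (\<lambda>X. X ** Y)" for Y :: "complex^'p^'n"
    by (rule linearI)
      (simp_all add: matrix_matrix_mult_def vec_eq_iff algebra_simps sum.distrib scaleR_sum_right)
  moreover have "linear (\<lambda>Y. X ** Y)" for X :: "complex^'n^'m"
    by (rule linearI)
      (simp_all add: matrix_matrix_mult_def vec_eq_iff algebra_simps sum.distrib scaleR_sum_right)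
  ultimately show ?thesis
    unfolding bilinear_conv_bounded_bilinear[symmetric] bilinear_def by blast
qed

interpretation matrix_mult:
  bounded_bilinear "(**) :: complex^'n^'m \<Rightarrow> complex^'p^'n \<Rightarrow> complex^'p^'m"
  by (rule bounded_bilinear_matrix_mult)

lemmas matrix_mult_bilinear_simps =
  matrix_mult.add_left matrix_mult.add_right matrix_mult.diff_left matrix_mult.diff_right
  matrix_mult.minus_left matrix_mult.minus_right
  matrix_mult.scaleR_left matrix_mult.scaleR_right

lemma trace_minus: "trace (- A) = - trace (A :: complex^'n^'n)"
  by (simp add: trace_def sum_negf)

lemma trace_scaleR: "trace (c *\<^sub>R A) = c *\<^sub>R trace (A :: complex^'n^'n)"
  by (simp add: trace_def scaleR_sum_right)

lemma bounded_linear_trace: "bounded_linear (trace :: complex^'n^'n \<Rightarrow> complex)"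
  unfolding linear_conv_bounded_linear[symmetric]
  by (rule linearI) (simp_all add: trace_add trace_scaleR)

lemma bounded_linear_trace_mult:
  "bounded_linear (\<lambda>X. trace (A ** X :: complex^'n^'n))"
  by (rule bounded_linear_compose[OF bounded_linear_trace matrix_mult.bounded_linear_right])

section \<open>Differentiating matrix inversion\<close>

lemma differentiable_matrix:
  fixes M :: "'a::real_normed_vector \<Rightarrow> complex^'n^'m"
  assumes "\<And>i j. (\<lambda>w. M w $ i $ j) differentiable (at z)"
  shows "M differentiable (at z)"
proof -
  obtain D where D: "\<And>i j. ((\<lambda>w. M w $ i $ j) has_derivative D i j) (at z)"
    using assms unfolding differentiable_def by metis
  have "(M has_derivative (\<lambda>h. \<chi> i j. D i j h)) (at z)"
    unfolding has_derivative_componentwise_within[of M]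
  proof
    fix b :: "complex^'n^'m"
    assume "b \<in> Basis"
    then obtain i j u where b: "b = axis i (axis j u)"
      by (auto simp: Basis_vec_def)
    show "((\<lambda>w. M w \<bullet> b) has_derivative (\<lambda>h. (\<chi> i j. D i j h) \<bullet> b)) (at z)"
      using D[of i j] by (auto simp: b inner_axis intro!: has_derivative_inner_left)
  qed
  then show ?thesis
    by (rule differentiableI)
qed

lemma differentiable_det:
  fixes M :: "'a::real_normed_vector \<Rightarrow> complex^'n^'n"
  assumes "\<And>i j. (\<lambda>w. M w $ i $ j) differentiable (at z)"
  shows "(\<lambda>w. det (M w)) differentiable (at z)"
proof -
  obtain D where D: "\<And>i j. ((\<lambda>w. M w $ i $ j) has_derivative D i j) (at z)"
    using assms unfolding differentiable_def by metis
  have "(\<lambda>w. \<Prod>i\<in>UNIV. M w $ i $ p i) differentiable (at z)" for p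
    unfolding differentiable_def by (rule exI, rule has_derivative_prod, rule D)
  then show ?thesis
    unfolding det_def
    by (intro differentiable_sum differentiable_mult differentiable_const ballI) auto
qed

lemma differentiable_entry: "(\<lambda>w :: complex^'n^'m. w $ i $ j) differentiable (at z)"
  by (intro bounded_linear_imp_differentiable bounded_linear_compose[OF bounded_linear_vec_nth]
      bounded_linear_vec_nth)

text \<open>Column \<open>j\<close> of the inverse solves \<open>z *v x = axis j 1\<close>, so
  Cramer's rule applies. This exhibits the entries of the inverse as quotients of polynomials in the
  entries of \<open>z\<close>.\<close>

lemma matrix_inv_cramer:
  fixes z :: "complex^'n^'n"
  assumes "z \<in> GL"
  shows "matrix_inv z $ k $ j =
    det (\<chi> i l. if l = k then axis j 1 $ i else z $ i $ l) / det z"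
proof -
  have "det z \<noteq> 0"
    using assms by (simp add: GL_def invertible_det_nz)
  moreover have "z *v (matrix_inv z *v axis j 1) = axis j 1"
    by (simp add: matrix_vector_mul_assoc matrix_inv_GL assms)
  ultimately have "matrix_inv z *v axis j 1 =
      (\<chi> k. det (\<chi> i l. if l = k then axis j 1 $ i else z $ i $ l) / det z)"
    using cramer by blast
  then have "(matrix_inv z *v axis j 1) $ k =
      det (\<chi> i l. if l = k then axis j 1 $ i else z $ i $ l) / det z"
    by simp
  then show ?thesis
    by (simp add: matrix_vector_mul_component inner_axis matrix_vector_mult_def axis_def if_distrib cong: if_cong)
qed

lemma differentiable_matrix_inv:
  fixes z :: "complex^'n^'n"
  assumes "z \<in> GL"
  shows "matrix_inv differentiable (at z)"
proof (rule differentiable_matrix)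
  fix k j
  have nz: "det z \<noteq> 0"
    using assms by (simp add: GL_def invertible_det_nz)
  let ?q = "\<lambda>z::complex^'n^'n. det (\<chi> i l. if l = k then axis j 1 $ i else z $ i $ l) / det z"
  have "(\<lambda>z. (\<chi> i l. if l = k then axis j 1 $ i else z $ i $ l) $ i $ l)
      differentiable (at z)" for i l
    by (cases "l = k") (simp_all add: differentiable_entry)
  then have "?q differentiable (at z)"
    using nz by (intro differentiable_divide differentiable_det differentiable_entry) 
  then obtain D where "(?q has_derivative D) (at z)"
    unfolding differentiable_def by blast
  then have "((\<lambda>z. matrix_inv z $ k $ j) has_derivative D) (at z)"
    by (rule has_derivative_transform_within_open[OF _ open_GL assms])
      (simp add: matrix_inv_cramer)
  then show "(\<lambda>z. matrix_inv z $ k $ j) differentiable (at z)"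
    by (rule differentiableI)
qed

text \<open>Once inversion is known to be differentiable, the product rule applied to the constant
  product \<open>w ** matrix_inv w\<close> determines its derivative.\<close>

lemma has_derivative_matrix_inv:
  fixes z :: "complex^'n^'n"
  assumes "z \<in> GL"
  shows "(matrix_inv has_derivative (\<lambda>X. - (matrix_inv z ** X ** matrix_inv z))) (at z)"
proof -
  obtain D where D: "(matrix_inv has_derivative D) (at z)"
    using differentiable_matrix_inv[OF assms] unfolding differentiable_def by blast
  have "((\<lambda>w. w ** matrix_inv w) has_derivative (\<lambda>X. z ** D X + X ** matrix_inv z)) (at z)"
    by (rule matrix_mult.FDERIV[OF has_derivative_ident D])
  moreover have "((\<lambda>w. w ** matrix_inv w) has_derivative (\<lambda>X. 0)) (at z)"
    \<comment> \<open>The product equals \<open>mat 1\<close> on \<open>GL\<close> only, which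
      suffices because \<open>GL\<close> is open.\<close>
    by (rule has_derivative_transform_within_open[OF has_derivative_const open_GL assms, of "mat 1"])
      (simp add: matrix_inv_GL)
  ultimately have "(\<lambda>X. z ** D X + X ** matrix_inv z) = (\<lambda>X. 0)"
    by (rule has_derivative_unique)
  then have "z ** D X = - (X ** matrix_inv z)" for X
    by (metis add_eq_0_iff2)
  then have "matrix_inv z ** (z ** D X) = - (matrix_inv z ** X ** matrix_inv z)" for X
    by (simp add: matrix_mult_bilinear_simps matrix_mul_assoc)
  then have "D = (\<lambda>X. - (matrix_inv z ** X ** matrix_inv z))"
    by (simp add: matrix_mul_assoc matrix_inv_GL assms fun_eq_iff)
  with D show ?thesis by simp
qed

section \<open>Real traces of left and right multiplication\<close>

lemma sum_Basis_vec:
  fixes f :: "'a::euclidean_space^'n \<Rightarrow> 'b::comm_monoid_add"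
  shows "(\<Sum>b\<in>Basis. f b) = (\<Sum>i\<in>UNIV. \<Sum>u\<in>Basis. f (axis i u))"
proof -
  have "(\<Sum>b\<in>Basis. f b) = (\<Sum>i\<in>UNIV. \<Sum>b\<in>(\<lambda>u. axis i u) ` Basis. f b)"
    unfolding Basis_vec_def
    by (subst sum.UNION_disjoint[symmetric])
      (auto simp: axis_eq_axis intro!: sum.cong)
  also have "\<dots> = (\<Sum>i\<in>UNIV. \<Sum>u\<in>Basis. f (axis i u))"
    by (intro sum.cong refl sum.reindex[unfolded o_def]) (auto simp: inj_on_def axis_eq_axis)
  finally show ?thesis .
qed

lemma sum_Basis_matrix:
  fixes f :: "complex^'n^'m \<Rightarrow> real"
  shows "(\<Sum>b\<in>Basis. f b) =
    (\<Sum>i\<in>UNIV. \<Sum>j\<in>UNIV. f (axis i (axis j 1)) + f (axis i (axis j \<i>)))"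
  by (simp add: sum_Basis_vec Basis_complex_def)

text \<open>Right multiplication acts on each of the \<open>n\<close> rows of \<open>b\<close>
  separately, with complex trace \<open>trace M\<close>. Passing to the real trace doubles the real
  part, since \<open>1\<close> and \<open>\<i>\<close> contribute equally.\<close>

lemma real_trace_mult_right:
  fixes M :: "complex^'n^'n"
  shows "(\<Sum>b::complex^'n^'n\<in>Basis. (b ** M) \<bullet> b) = 2 * real CARD('n) * Re (trace M)"
proof -
  have "axis i (axis j u) $ i $ k * M $ k $ j = (if k = j then u * M $ j $ j else 0)"
    for i j k :: 'n and u
    by (simp add: axis_def)
  then have "(axis i (axis j u) ** M) $ i $ j = u * M $ j $ j" for i j :: 'n and u
    by (simp add: matrix_matrix_mult_def)
  then have "(\<Sum>b::complex^'n^'n\<in>Basis. (b ** M) \<bullet> b) =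
      (\<Sum>i\<in>(UNIV::'n set). \<Sum>j\<in>UNIV. 2 * Re (M $ j $ j))"
    by (simp only: sum_Basis_matrix inner_axis) (simp add: inner_complex_def)
  then show ?thesis
    by (simp add: trace_def sum_distrib_left mult_ac)
qed

lemma real_trace_mult_left:
  fixes M :: "complex^'n^'n"
  shows "(\<Sum>b::complex^'n^'n\<in>Basis. (M ** b) \<bullet> b) = 2 * real CARD('n) * Re (trace M)"
proof -
  have "M $ i $ k * axis i (axis j u) $ k $ j = (if k = i then M $ i $ i * u else 0)"
    for i j k :: 'n and u
    by (simp add: axis_def)
  then have "(M ** axis i (axis j u)) $ i $ j = M $ i $ i * u" for i j :: 'n and u
    by (simp add: matrix_matrix_mult_def)
  then have "(\<Sum>b::complex^'n^'n\<in>Basis. (M ** b) \<bullet> b) =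
      (\<Sum>i\<in>UNIV. \<Sum>j\<in>(UNIV::'n set). 2 * Re (M $ i $ i))"
    by (simp only: sum_Basis_matrix inner_axis) (simp add: inner_complex_def)
  then show ?thesis
    by (simp add: trace_def sum_distrib_left mult_ac)
qed

section \<open>Gradient and Levi-Civita connection of the metric\<close>

text \<open>Nondegeneracy gives the uniqueness behind both definite descriptions:
  \<open>c = 1\<close> serves the gradient, \<open>c = 2\<close> the Koszul formula.\<close>

lemma gl_metric_the:
  fixes z X :: "complex^'n^'n"
  assumes "z \<in> GL" and c: "c \<noteq> 0" and "\<And>Y. c * gl_metric z X Y = F Y"
  shows "(THE X. \<forall>Y. c * gl_metric z X Y = F Y) = X"
proof (rule the_equality)
  fix X' assume "\<forall>Y. c * gl_metric z X' Y = F Y"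
  then have "gl_metric z X' Y = gl_metric z X Y" for Y
    using assms by (metis mult_left_cancel)
  then have "gl_metric z (X' - X) Y = 0" for Y
    by (simp add: bilinear_lsub[OF gl_metric_bilinear])
  then have "X' - X = 0"
    by (rule gl_metric_nondegenerate[OF assms(1)])
  then show "X' = X" by simp
qed (use assms in simp)

lemma gl_metric_alt:
  "gl_metric z X Y = - Re (trace (matrix_inv z ** X ** matrix_inv z ** Y))"
  by (simp add: gl_metric_def gl_form_def matrix_mul_assoc)

lemma matrix_inv_cancel:
  assumes "z \<in> GL"
  shows "A ** z ** matrix_inv z = A" "A ** matrix_inv z ** z = A"
  by (simp_all add: matrix_inv_GL assms flip: matrix_mul_assoc)

text \<open>The two inverses in the metric cancel the outer factors of \<open>z ** A ** z\<close>,
  leaving \<open>Re (trace (A ** Y))\<close>. The formula for \<open>f\<close> is assumed on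
  \<open>GL\<close> only, because \<open>phi\<close> vanishes elsewhere.\<close>

lemma gradient_Re_trace:
  fixes A :: "complex^'n^'n"
  assumes f: "\<And>w. w \<in> GL \<Longrightarrow> f w = Re (trace (A ** w))" and z: "z \<in> GL"
  shows "gradient gl_metric f z = - (z ** A ** z)"
proof -
  have "((\<lambda>w. Re (trace (A ** w))) has_derivative (\<lambda>w. Re (trace (A ** w)))) (at z)"
    by (intro bounded_linear_imp_has_derivative
        bounded_linear_compose[OF bounded_linear_Re bounded_linear_trace_mult])
  then have "(f has_derivative (\<lambda>w. Re (trace (A ** w)))) (at z)"
    by (rule has_derivative_transform_within_open[OF _ open_GL z]) (simp add: f)
  then have "frechet_derivative f (at z) = (\<lambda>w. Re (trace (A ** w)))"
    by (rule frechet_derivative_at[symmetric])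
  then show ?thesis
    unfolding gradient_def
    using gl_metric_the[OF z, of 1 "- (z ** A ** z)" "\<lambda>w. Re (trace (A ** w))"]
    by (simp add: gl_metric_alt matrix_mult_bilinear_simps matrix_mul_assoc matrix_inv_GL
        matrix_inv_cancel z trace_minus)
qed

text \<open>One term arises from each of the two inverses in the metric; the sign of the derivative
  of inversion cancels that of the metric.\<close>

lemma frechet_derivative_gl_metric:
  fixes z :: "complex^'n^'n"
  assumes z: "z \<in> GL"
  defines "P \<equiv> matrix_inv z"
  shows "frechet_derivative (\<lambda>w. gl_metric w Y Z) (at z) X =
    Re (trace (P ** X ** P ** Y ** P ** Z)) + Re (trace (P ** Y ** P ** X ** P ** Z))"
proof -
  note d = has_derivative_matrix_inv[OF z, folded P_def]
  have "((\<lambda>w. matrix_inv w ** Y ** matrix_inv w ** Z) has_derivative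
      (\<lambda>X. (P ** Y ** - (P ** X ** P) + - (P ** X ** P) ** Y ** P) ** Z)) (at z)"
    using matrix_mult.FDERIV[OF bounded_linear.has_derivative[OF
        matrix_mult.bounded_linear_left[of Y] d] d]
    by (intro bounded_linear.has_derivative[OF matrix_mult.bounded_linear_left]) (simp add: P_def)
  then have "((\<lambda>w. gl_metric w Y Z) has_derivative
      (\<lambda>X. - Re (trace ((P ** Y ** - (P ** X ** P) + - (P ** X ** P) ** Y ** P) ** Z)))) (at z)"
    unfolding gl_metric_alt
    by (intro has_derivative_minus bounded_linear.has_derivative[OF bounded_linear_Re]
        bounded_linear.has_derivative[OF bounded_linear_trace])
  from frechet_derivative_at[OF this, symmetric] show ?thesis
    by (simp add: matrix_mult_bilinear_simps trace_add trace_minus trace_sub matrix_mul_assoc)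
qed

lemma christoffel_gl_metric:
  fixes z :: "complex^'n^'n"
  assumes z: "z \<in> GL"
  shows "christoffel gl_metric z X Y =
    (- (1/2)) *\<^sub>R (X ** matrix_inv z ** Y + Y ** matrix_inv z ** X)"
  unfolding christoffel_def
proof (rule gl_metric_the[OF z])
  fix Z
  define P where "P = matrix_inv z"
  \<comment> \<open>Cyclic shifts bring \<open>Z\<close> to the end. The derivative along
    \<open>Z\<close> then cancels one of the two equal derivatives along \<open>X\<close> and
    \<open>Y\<close>.\<close>
  have "trace (P ** Z ** P ** X ** P ** Y) = trace (P ** X ** P ** Y ** P ** Z)"
    "trace (P ** X ** P ** Z ** P ** Y) = trace (P ** Y ** P ** X ** P ** Z)"
    using trace_mul_sym[of "P ** Z" "P ** X ** P ** Y"]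
      trace_mul_sym[of "P ** X ** P ** Z" "P ** Y"]
    by (simp_all add: matrix_mul_assoc)
  then show "2 * gl_metric z ((- (1/2)) *\<^sub>R (X ** matrix_inv z ** Y + Y ** matrix_inv z ** X)) Z =
      frechet_derivative (\<lambda>w. gl_metric w Y Z) (at z) X
      + frechet_derivative (\<lambda>w. gl_metric w X Z) (at z) Y
      - frechet_derivative (\<lambda>w. gl_metric w X Y) (at z) Z"
    unfolding frechet_derivative_gl_metric[OF z]
    by (simp add: gl_metric_alt matrix_mult_bilinear_simps
        trace_add trace_minus trace_sub trace_scaleR matrix_mul_assoc flip: P_def)
qed simp

lemma divergence_gradient_Re_trace:
  fixes A :: "complex^'n^'n"
  assumes f: "\<And>w. w \<in> GL \<Longrightarrow> f w = Re (trace (A ** w))" and z: "z \<in> GL"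
  shows "divergence gl_metric (gradient gl_metric f) z = - 2 * real CARD('n) * f z"
proof -
  have "((\<lambda>w. - (w ** A ** w)) has_derivative (\<lambda>X. - (z ** A ** X + X ** A ** z))) (at z)"
    by (intro has_derivative_minus matrix_mult.FDERIV has_derivative_ident
        bounded_linear_imp_has_derivative matrix_mult.bounded_linear_left)
  then have "(gradient gl_metric f has_derivative (\<lambda>X. - (z ** A ** X + X ** A ** z))) (at z)"
    by (rule has_derivative_transform_within_open[OF _ open_GL z])
      (simp add: gradient_Re_trace[OF f])
  then have "frechet_derivative (gradient gl_metric f) (at z) =
      (\<lambda>X. - (z ** A ** X + X ** A ** z))"
    by (rule frechet_derivative_at[symmetric])
  moreover have "gradient gl_metric f z = - (z ** A ** z)"
    by (rule gradient_Re_trace[OF f z])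
  \<comment> \<open>The Christoffel term cancels half of the ordinary derivative. What remains is
    built from left multiplication by \<open>z ** A\<close> and right multiplication by
    \<open>A ** z\<close>, whose real traces agree by cyclicity.\<close>
  ultimately have "covariant_derivative gl_metric (gradient gl_metric f) z X =
      (- (1/2)) *\<^sub>R ((z ** A) ** X + X ** (A ** z))" for X
    unfolding covariant_derivative_def christoffel_gl_metric[OF z]
    by (simp add: matrix_mult_bilinear_simps matrix_mul_assoc matrix_inv_cancel matrix_inv_GL z)
      (simp add: algebra_simps flip: scaleR_add_left)
  then have "divergence gl_metric (gradient gl_metric f) z =
      - (1/2) * ((\<Sum>b::complex^'n^'n\<in>Basis. ((z ** A) ** b) \<bullet> b) + (\<Sum>b::complex^'n^'n\<in>Basis. (b ** (A ** z)) \<bullet> b))"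
    by (simp add: divergence_def inner_add_left sum.distrib sum_distrib_left
        sum_divide_distrib add_divide_distrib sum_negf sum_subtractf)
  then show ?thesis
    by (simp add: real_trace_mult_left real_trace_mult_right f z trace_mul_sym[of z A])
qed

section \<open>The functions \<open>phi v a\<close>\<close>

definition outer :: "complex^'n \<Rightarrow> complex^'n \<Rightarrow> complex^'n^'n" where
  "outer a v = (\<chi> i j. a $ i * v $ j)"

text \<open>Transposing the product inside the trace reverses its factors and frees \<open>z\<close>
  of its transpose; a cyclic shift then moves \<open>z\<close> to the right. In coordinates this is
  an interchange of sums.\<close>

lemma phi_trace:
  assumes "z \<in> GL"
  shows "phi v a z = trace (outer a v ** z)"
proof -
  have "phi v a z = (\<Sum>i\<in>UNIV. \<Sum>k\<in>UNIV. v $ i * a $ k * z $ i $ k)"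
    using assms
    by (simp add: phi_def trace_def matrix_matrix_mult_def transpose_def rowvector_def)
  also have "\<dots> = (\<Sum>k\<in>UNIV. \<Sum>i\<in>UNIV. v $ i * a $ k * z $ i $ k)"
    by (rule sum.swap)
  finally show ?thesis
    by (simp add: trace_def matrix_matrix_mult_def outer_def mult.commute)
qed

lemma trace_outer_mult: "trace (outer a v ** X) = (\<Sum>i\<in>UNIV. \<Sum>j\<in>UNIV. a $ i * v $ j * X $ j $ i)"
  by (simp add: trace_def matrix_matrix_mult_def outer_def)

text \<open>The middle factor \<open>v z b\<^sup>t\<close> of the product is a scalar, equal to
  \<open>trace (outer b v ** z)\<close>, and can be pulled out.\<close>

lemma trace_outer_mult_outer:
  "trace (outer a v ** z ** outer b v ** z) = trace (outer a v ** z) * trace (outer b v ** z)"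
proof -
  define c where "c = trace (outer b v ** z)"
  have "(outer a v ** z ** outer b v) $ i $ j = c * outer a v $ i $ j" for i j
  proof -
    have "(outer a v ** z ** outer b v) $ i $ j =
        (\<Sum>k\<in>UNIV. \<Sum>l\<in>UNIV. b $ k * v $ l * z $ l $ k * (a $ i * v $ j))"
      by (simp add: matrix_matrix_mult_def outer_def sum_distrib_right sum_distrib_left mult_ac)
    then show ?thesis
      by (simp add: c_def trace_outer_mult sum_distrib_right) (simp add: outer_def)
  qed
  then have "outer a v ** z ** outer b v = (\<chi> i j. c * outer a v $ i $ j)"
    by (simp add: vec_eq_iff)
  then have "trace (outer a v ** z ** outer b v ** z) = c * trace (outer a v ** z)"
    by (simp add: trace_def matrix_matrix_mult_def sum_distrib_left mult_ac)
  then show ?thesis by (simp add: c_def mult.commute)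
qed

section \<open>Linear dependence on the vector \<open>a\<close>\<close>

lemma phi_add: "phi v (a + b) z = phi v a z + phi v b z"
  by (cases "z \<in> GL")
    (simp_all add: phi_trace trace_outer_mult algebra_simps sum.distrib, simp_all add: phi_def)

lemma phi_scale: "phi v (c *s a) z = c * phi v a z"
  by (cases "z \<in> GL")
    (simp_all add: phi_trace trace_outer_mult mult.assoc sum_distrib_left, simp_all add: phi_def)

lemma phi_minus: "phi v (- a) z = - phi v a z"
  using phi_scale[of v "- 1" a z] by (simp add: vector_sneg_minus1[symmetric])

lemma phi_linear:
  "Vector_Spaces.linear (*s) (\<lambda>(c::complex) f x. c * f x) (phi v :: complex^'n \<Rightarrow> _)"
  unfolding Vector_Spaces.linear_iff
  by (simp add: vec.vector_space_axioms cfun.vector_space_axioms fun_eq_iff phi_add phi_scale)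

lemma Re_phi: "z \<in> GL \<Longrightarrow> Re (phi v a z) = Re (trace (outer a v ** z))"
  by (simp add: phi_trace)

lemma Im_phi: "z \<in> GL \<Longrightarrow> Im (phi v a z) = Re (trace (outer (- (\<i> *s a)) v ** z))"
  by (simp add: phi_minus phi_scale flip: phi_trace)

section \<open>Smoothness and injectivity\<close>

lemma Ck_on_cong:
  assumes "open U" and "\<And>z. z \<in> U \<Longrightarrow> f z = h z"
  shows "Ck_on k U f \<longleftrightarrow> Ck_on k U h"
  using assms(2)
proof (induction k arbitrary: f h)
  case 0
  then show ?case by (simp cong: continuous_on_cong)
next
  case (Suc k)
  \<comment> \<open>Near a point of the open set \<open>U\<close> the two functions coincide, so
    their derivatives there agree; the induction continues with these derivatives.\<close>
  have D: "(f has_derivative D) (at z) \<longleftrightarrow> (h has_derivative D) (at z)" if "z \<in> U" for z D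
    by (auto elim!: has_derivative_transform_within_open[OF _ assms(1) that] simp: Suc.prems)
  then have "frechet_derivative f (at z) = frechet_derivative h (at z)" if "z \<in> U" for z
    using that by (simp add: frechet_derivative_def)
  then have "Ck_on k U (\<lambda>z. frechet_derivative f (at z) v)
      \<longleftrightarrow> Ck_on k U (\<lambda>z. frechet_derivative h (at z) v)" for v
    by (intro Suc.IH) simp
  with D show ?case by (simp add: differentiable_def)
qed

lemma Ck_on_const: "Ck_on k U (\<lambda>z. c)"
  by (induction k arbitrary: c) simp_all

lemma smooth_on_bounded_linear:
  assumes "bounded_linear f"
  shows "smooth_on U f"
  unfolding smooth_on_def
proof
  fix k
  have "f differentiable (at z)" and "frechet_derivative f (at z) = f" for z
    using bounded_linear_imp_has_derivative[OF assms]
    by (auto intro: differentiableI frechet_derivative_at[symmetric])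
  then show "Ck_on k U f"
    \<comment> \<open>The derivative is \<open>f\<close> at every point, so each directional
      derivative is already constant.\<close>
    by (cases k) (simp_all add: Ck_on_const assms linear_continuous_on)
qed

lemma smooth_on_phi: "smooth_on GL (phi v a)"
  using smooth_on_bounded_linear[OF bounded_linear_trace_mult, of GL "outer a v"]
  unfolding smooth_on_def by (simp add: Ck_on_cong[OF open_GL phi_trace])

text \<open>Equality of the functions compares the linear forms on \<open>GL\<close> only, which
  contains no matrix unit when \<open>n > 1\<close>. Their derivatives at the identity are the full
  linear forms and can be evaluated at matrix units.\<close>

lemma inj_phi:
  fixes v :: "complex^'n"
  assumes "v \<noteq> 0"
  shows "inj (phi v)"
proof (rule injI)
  fix a b
  assume ab: "phi v a = phi v b"
  have "invertible (mat 1 :: complex^'n^'n)"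
    unfolding invertible_def by (rule exI[of _ "mat 1"]) simp
  then have GL: "(mat 1 :: complex^'n^'n) \<in> GL"
    by (simp add: GL_def)
  have D: "(phi v c has_derivative (\<lambda>X. trace (outer c v ** X))) (at (mat 1))" for c
    by (rule has_derivative_transform_within_open[OF
          bounded_linear_imp_has_derivative[OF bounded_linear_trace_mult] open_GL GL])
      (simp add: phi_trace)
  have "(\<lambda>X. trace (outer a v ** X)) = (\<lambda>X. trace (outer b v ** X))"
    using has_derivative_unique[OF D[of a, unfolded ab] D[of b]] .
  moreover have "trace (outer c v ** axis j (axis i 1)) = c $ i * v $ j" for c i j
  proof -
    have "c $ k * v $ l * axis j (axis i 1) $ l $ k =
        (if l = j then if k = i then c $ i * v $ j else 0 else 0)" for k l
      by (simp add: axis_def)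
    then show ?thesis
      by (simp add: trace_outer_mult)
  qed
  ultimately have "a $ i * v $ j = b $ i * v $ j" for i j
    by metis
  moreover obtain j where "v $ j \<noteq> 0"
    using assms by (auto simp: vec_eq_iff)
  ultimately show "a = b"
    by (metis mult_right_cancel vec_eq_iff)
qed

section \<open>The eigenvalue equations and the theorem\<close>

lemma tension_phi:
  fixes v :: "complex^'n"
  assumes "z \<in> GL"
  shows "tension gl_metric (phi v a) z = - 2 * of_nat CARD('n) * phi v a z"
  using divergence_gradient_Re_trace[OF Re_phi assms, of v a]
    divergence_gradient_Re_trace[OF Im_phi assms, of v a]
  by (simp add: tension_def complex_divergence_def complex_gradient_def complex_eq_iff)

lemma conformality_phi:
  assumes "z \<in> GL"
  shows "conformality gl_metric (phi v a) (phi v b) z = - 2 * phi v a z * phi v b z"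
proof -
  \<comment> \<open>Stated for all \<open>a\<close> and \<open>b\<close>, this also covers the
    gradients of imaginary parts, where \<open>a\<close> is replaced by
    \<open>- (\<i> *s a)\<close>. In each component of the complex bilinear extension the two terms
    are then equal, whence the factor 2.\<close>
  have "gl_metric z (- (z ** outer a v ** z)) (- (z ** outer b v ** z)) =
      - Re (phi v a z * phi v b z)" for a b
    using assms
    by (simp add: gl_metric_alt matrix_mult_bilinear_simps matrix_mul_assoc matrix_inv_cancel
        matrix_inv_GL trace_outer_mult_outer phi_trace)
  moreover have "gradient gl_metric (\<lambda>w. Re (phi v a w)) z = - (z ** outer a v ** z)" for a
    by (rule gradient_Re_trace[OF Re_phi assms])
  moreover have "gradient gl_metric (\<lambda>w. Im (phi v a w)) z =
      - (z ** outer (- (\<i> *s a)) v ** z)" for a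
    by (rule gradient_Re_trace[OF Im_phi assms])
  ultimately show ?thesis
    by (simp add: conformality_def complex_bilinear_extension_def complex_gradient_def
        complex_eq_iff phi_minus phi_scale)
qed

theorem theorem5p3:
  fixes v :: "complex^'n"
  assumes "v \<noteq> 0"
  shows "cfun.subspace (E_fam v) \<and> cfun.dim (E_fam v) = CARD('n)
    \<and> eigenfamily GL gl_metric (E_fam v)
    \<and> (\<forall>\<phi>\<in>E_fam v. \<forall>\<psi>\<in>E_fam v. \<forall>z\<in>GL.
          tension gl_metric \<phi> z = - 2 * of_nat CARD('n) * \<phi> z
        \<and> conformality gl_metric \<phi> \<psi> z = - 2 * \<phi> z * \<psi> z)"
proof -
  \<comment> \<open>Only the source of \<open>phi v\<close> is finite-dimensional; the space of all
    functions on matrices is not.\<close>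
  interpret pair: finite_dimensional_vector_space_pair_1 "(*s)" cart_basis
    "\<lambda>(c::complex) (f::complex^'n^'n \<Rightarrow> complex) x. c * f x"
    by unfold_locales
  have E: "E_fam v = range (phi v)"
    by (auto simp: E_fam_def)
  have "cfun.subspace (E_fam v)"
    unfolding E by (intro pair.linear_subspace_image[OF phi_linear] vec.subspace_UNIV)
  moreover have "cfun.dim (E_fam v) = CARD('n)"
    unfolding E using pair.dim_image_eq[OF phi_linear, of v UNIV] inj_phi[OF assms]
    by (simp only: vec_dim_card vec.span_UNIV)
  moreover have *: "\<forall>\<phi>\<in>E_fam v. \<forall>\<psi>\<in>E_fam v. \<forall>z\<in>GL.
          tension gl_metric \<phi> z = - 2 * of_nat CARD('n) * \<phi> z
        \<and> conformality gl_metric \<phi> \<psi> z = - 2 * \<phi> z * \<psi> z"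
    unfolding E by (auto simp only: tension_phi conformality_phi)
  moreover have "eigenfamily GL gl_metric (E_fam v)"
    unfolding eigenfamily_def
    using * by (intro conjI exI[of _ "- 2 * of_nat CARD('n)"] exI[of _ "- 2"])
      (auto simp: E smooth_on_phi)
  ultimately show ?thesis by blast
qed

end
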